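(* Let $k$ be a field, $G$ a finite group, and $W=\bigoplus_{g\in G}W_g$ a $G$-graded twisted $k$-algebra (not necessarily associative or commutative). Fix a basis $B=\{v_g: g\in G\}$ of $W$ with $v_g\in W_g$ and $v_e=1$, let $C:G\times G\to A$ be the structure constant of $W$ with respect to $B$, where $A$ is a subgroup of $k^*$ containing all values of $C$, and let $R=k[A\times_C G]$ be the loop ring over $k$ of the loop $A\times_C G$. Let $I\subset R$ be the $k$-linear subspace spanned by all elements $(\alpha,g)-\alpha\,(1,g)$ with $\alpha\in A$, $g\in G$. Then $I$ is a two-sided ideal of $R$, and the quotient $R/I$ is a $k$-algebra isomorphic to $W$.
   Context: A $G$-graded twisted $k$-algebra is a $k$-algebra $W$ (not necessarily commutative or associative) with a grading $W=\bigoplus_{g\in G}W_g$, $W_aW_b\subset W_{ab}$, such that each $W_g$ is one-dimensional over $k$, $w_aw_b\neq 0$ for all nonzero $w_a\in W_a$, $w_b\in W_b$ (all $a,b\in G$), and $W$ has an identity element $1\in W_e$, where $e$ is the identity of $G$. For a basis $B=\{v_g\}$ with $v_g\in W_g$, the structure constant is the function $C:G\times G\to k^*$ determined by $v_av_b=C(a,b)v_{ab}$. $A\times_C G$ denotes the set $A\times G$ with the operation $(\alpha,a)\cdot(\beta,b)=(\alpha\beta C(a,b),ab)$; this is a loop (a not necessarily associative analogue of a group). Its loop ring $k[A\times_C G]$ is the $k$-vector space with basis $A\times_C G$ and multiplication obtained by extending the loop operation bilinearly. *)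

theory Defs
  imports "HOL-Algebra.QuotRing" "HOL-Algebra.Multiplicative_Group"
begin

text \<open>
  Algebras that need not be associative, commutative or unital reuse the library record
  \<^typ>\<open>('a, 'b) module\<close>, which carries \<open>mult\<close> and \<open>one\<close> besides the module operations.
  Nothing is assumed here about the \<open>one\<close> field.
\<close>

locale nonassoc_algebra = module +
  assumes mult_closed:
      "\<lbrakk>x \<in> carrier M; y \<in> carrier M\<rbrakk> \<Longrightarrow> x \<otimes>\<^bsub>M\<^esub> y \<in> carrier M"
    and mult_l_distr:
      "\<lbrakk>x \<in> carrier M; y \<in> carrier M; z \<in> carrier M\<rbrakk> \<Longrightarrow>
        (x \<oplus>\<^bsub>M\<^esub> y) \<otimes>\<^bsub>M\<^esub> z = x \<otimes>\<^bsub>M\<^esub> z \<oplus>\<^bsub>M\<^esub> y \<otimes>\<^bsub>M\<^esub> z"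
    and mult_r_distr:
      "\<lbrakk>x \<in> carrier M; y \<in> carrier M; z \<in> carrier M\<rbrakk> \<Longrightarrow>
        z \<otimes>\<^bsub>M\<^esub> (x \<oplus>\<^bsub>M\<^esub> y) = z \<otimes>\<^bsub>M\<^esub> x \<oplus>\<^bsub>M\<^esub> z \<otimes>\<^bsub>M\<^esub> y"
    and smult_mult_l:
      "\<lbrakk>c \<in> carrier R; x \<in> carrier M; y \<in> carrier M\<rbrakk> \<Longrightarrow>
        (c \<odot>\<^bsub>M\<^esub> x) \<otimes>\<^bsub>M\<^esub> y = c \<odot>\<^bsub>M\<^esub> (x \<otimes>\<^bsub>M\<^esub> y)"
    and smult_mult_r:
      "\<lbrakk>c \<in> carrier R; x \<in> carrier M; y \<in> carrier M\<rbrakk> \<Longrightarrow>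
        x \<otimes>\<^bsub>M\<^esub> (c \<odot>\<^bsub>M\<^esub> y) = c \<odot>\<^bsub>M\<^esub> (x \<otimes>\<^bsub>M\<^esub> y)"

definition lin_span ::
    "('a, 'r) ring_scheme \<Rightarrow> ('a, 'b, 'm) module_scheme \<Rightarrow> 'b set \<Rightarrow> 'b set"
  where "lin_span K M S = (\<lambda>H. submodule H K M) hull S"

definition is_basis ::
    "('a, 'r) ring_scheme \<Rightarrow> ('a, 'b, 'm) module_scheme \<Rightarrow> 'i set \<Rightarrow> ('i \<Rightarrow> 'b) \<Rightarrow> bool"
  where "is_basis K M J v \<longleftrightarrow>
    v \<in> J \<rightarrow> carrier M \<and>
    (\<forall>x\<in>carrier M. \<exists>!c. c \<in> J \<rightarrow>\<^sub>E carrier K \<and> finite {j\<in>J. c j \<noteq> \<zero>\<^bsub>K\<^esub>} \<and>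
       x = (\<Oplus>\<^bsub>M\<^esub>j\<in>{j\<in>J. c j \<noteq> \<zero>\<^bsub>K\<^esub>}. c j \<odot>\<^bsub>M\<^esub> v j))"

definition is_direct_sum ::
    "('a, 'r) ring_scheme \<Rightarrow> ('a, 'b, 'm) module_scheme \<Rightarrow> 'i set \<Rightarrow> ('i \<Rightarrow> 'b set) \<Rightarrow> bool"
  where "is_direct_sum K M J V \<longleftrightarrow>
    (\<forall>j\<in>J. submodule (V j) K M) \<and>
    (\<forall>x\<in>carrier M. \<exists>!f. f \<in> Pi\<^sub>E J V \<and> finite {j\<in>J. f j \<noteq> \<zero>\<^bsub>M\<^esub>} \<and>
       x = (\<Oplus>\<^bsub>M\<^esub>j\<in>{j\<in>J. f j \<noteq> \<zero>\<^bsub>M\<^esub>}. f j))"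

definition one_dimensional ::
    "('a, 'r) ring_scheme \<Rightarrow> ('a, 'b, 'm) module_scheme \<Rightarrow> 'b set \<Rightarrow> bool"
  where "one_dimensional K M V \<longleftrightarrow>
    (\<exists>v\<in>V. v \<noteq> \<zero>\<^bsub>M\<^esub> \<and> V = {c \<odot>\<^bsub>M\<^esub> v | c. c \<in> carrier K})"

text \<open>\<open>V g\<close> is the homogeneous component of \<open>W\<close> of degree \<open>g\<close>.\<close>

locale graded_twisted_algebra = nonassoc_algebra K W
  for K (structure) and G (structure) and W (structure) and V +
  assumes grading: "is_direct_sum K W (carrier G) V"
    and graded_mult:
      "\<lbrakk>a \<in> carrier G; b \<in> carrier G; x \<in> V a; y \<in> V b\<rbrakk> \<Longrightarrow>
        x \<otimes>\<^bsub>W\<^esub> y \<in> V (a \<otimes>\<^bsub>G\<^esub> b)"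
    and one_dim: "g \<in> carrier G \<Longrightarrow> one_dimensional K W (V g)"
    and mult_nonzero:
      "\<lbrakk>a \<in> carrier G; b \<in> carrier G; x \<in> V a; y \<in> V b; x \<noteq> \<zero>\<^bsub>W\<^esub>; y \<noteq> \<zero>\<^bsub>W\<^esub>\<rbrakk> \<Longrightarrow>
        x \<otimes>\<^bsub>W\<^esub> y \<noteq> \<zero>\<^bsub>W\<^esub>"
    and one_in: "\<one>\<^bsub>W\<^esub> \<in> V \<one>\<^bsub>G\<^esub>"
    and one_mult: "x \<in> carrier W \<Longrightarrow> \<one>\<^bsub>W\<^esub> \<otimes>\<^bsub>W\<^esub> x = x"
    and mult_one: "x \<in> carrier W \<Longrightarrow> x \<otimes>\<^bsub>W\<^esub> \<one>\<^bsub>W\<^esub> = x"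

definition structure_constant ::
    "('a, 'r) ring_scheme \<Rightarrow> ('g, 'h) monoid_scheme \<Rightarrow> ('a, 'b, 'm) module_scheme \<Rightarrow>
      ('g \<Rightarrow> 'b) \<Rightarrow> ('g \<Rightarrow> 'g \<Rightarrow> 'a) \<Rightarrow> bool"
  where "structure_constant K G W v C \<longleftrightarrow>
    (\<forall>a\<in>carrier G. \<forall>b\<in>carrier G.
       C a b \<in> carrier (mult_of K) \<and> v a \<otimes>\<^bsub>W\<^esub> v b = C a b \<odot>\<^bsub>W\<^esub> v (a \<otimes>\<^bsub>G\<^esub> b))"

text \<open>
  The library record \<open>monoid\<close> only provides the signature; the operation is in general not
  associative.  The pair of units is the identity because \<open>C a b = 1\<close> as soon as \<open>a\<close> or \<open>b\<close>
  is the identity of \<open>G\<close>, which holds for bases normalized by \<open>v 1 = 1\<close>.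
\<close>

definition twisted_loop ::
    "('a, 'r) ring_scheme \<Rightarrow> 'a set \<Rightarrow> ('g \<Rightarrow> 'g \<Rightarrow> 'a) \<Rightarrow> ('g, 'h) monoid_scheme \<Rightarrow> ('a \<times> 'g) monoid"
  where "twisted_loop K A C G =
    \<lparr>carrier = A \<times> carrier G,
     mult = (\<lambda>(\<alpha>, a) (\<beta>, b). (\<alpha> \<otimes>\<^bsub>K\<^esub> \<beta> \<otimes>\<^bsub>K\<^esub> C a b, a \<otimes>\<^bsub>G\<^esub> b)),
     one = (\<one>\<^bsub>K\<^esub>, \<one>\<^bsub>G\<^esub>)\<rparr>"

text \<open>
  The free module on a loop consists of the finitely supported coefficient functions, taken to
  be zero outside the carrier of the loop; the product is the convolution, that is, the bilinear
  extension of the loop operation.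
\<close>

definition loop_basis :: "('a, 'r) ring_scheme \<Rightarrow> 'l \<Rightarrow> 'l \<Rightarrow> 'a"
  where "loop_basis K x = (\<lambda>y. if y = x then \<one>\<^bsub>K\<^esub> else \<zero>\<^bsub>K\<^esub>)"

definition loop_ring ::
    "('a, 'r) ring_scheme \<Rightarrow> ('l, 'n) monoid_scheme \<Rightarrow> ('a, 'l \<Rightarrow> 'a) module"
  where "loop_ring K L =
    \<lparr>carrier = {f. range f \<subseteq> carrier K \<and> finite {x. f x \<noteq> \<zero>\<^bsub>K\<^esub>} \<and>
                   {x. f x \<noteq> \<zero>\<^bsub>K\<^esub>} \<subseteq> carrier L},
     mult = (\<lambda>f h z.
       \<Oplus>\<^bsub>K\<^esub>p\<in>{(x, y). f x \<noteq> \<zero>\<^bsub>K\<^esub> \<and> h y \<noteq> \<zero>\<^bsub>K\<^esub> \<and> x \<otimes>\<^bsub>L\<^esub> y = z}.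
         f (fst p) \<otimes>\<^bsub>K\<^esub> h (snd p)),
     one = loop_basis K \<one>\<^bsub>L\<^esub>,
     zero = (\<lambda>_. \<zero>\<^bsub>K\<^esub>),
     add = (\<lambda>f h z. f z \<oplus>\<^bsub>K\<^esub> h z),
     smult = (\<lambda>c f z. c \<otimes>\<^bsub>K\<^esub> f z)\<rparr>"

text \<open>The library's \<open>ideal\<close> presupposes an associative ambient ring.\<close>

locale algebra_ideal = nonassoc_algebra K M + submodule I K M
  for K (structure) and M (structure) and I +
  assumes ideal_l_closed: "\<lbrakk>x \<in> carrier M; y \<in> I\<rbrakk> \<Longrightarrow> x \<otimes>\<^bsub>M\<^esub> y \<in> I"
    and ideal_r_closed: "\<lbrakk>x \<in> carrier M; y \<in> I\<rbrakk> \<Longrightarrow> y \<otimes>\<^bsub>M\<^esub> x \<in> I"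

text \<open>
  The fields up to \<open>add\<close> are those of the library quotient \<open>M Quot I\<close>; scalar multiplication is
  induced on cosets in the same style as \<^const>\<open>rcoset_mult\<close>.
\<close>

definition quotient_algebra ::
    "('a, 'b, 'm) module_scheme \<Rightarrow> 'b set \<Rightarrow> ('a, 'b set) module"
  where "quotient_algebra M I =
    \<lparr>carrier = a_rcosets\<^bsub>M\<^esub> I, mult = rcoset_mult M I,
     one = I +>\<^bsub>M\<^esub> \<one>\<^bsub>M\<^esub>, zero = I, add = set_add M,
     smult = (\<lambda>c X. \<Union>x\<in>X. I +>\<^bsub>M\<^esub> (c \<odot>\<^bsub>M\<^esub> x))\<rparr>"

definition algebra_iso ::
    "('a, 'r) ring_scheme \<Rightarrow> ('a, 'b, 'm) module_scheme \<Rightarrow> ('a, 'c, 'n) module_scheme \<Rightarrow>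
      ('b \<Rightarrow> 'c) set"
  where "algebra_iso K M N =
    {h \<in> ring_iso M N. \<forall>c\<in>carrier K. \<forall>x\<in>carrier M. h (c \<odot>\<^bsub>M\<^esub> x) = c \<odot>\<^bsub>N\<^esub> h x}"

end

theory Submission
  imports Defs
begin

text \<open>
  The map \<open>(\<alpha>, g) \<mapsto> \<alpha> v\<^sub>g\<close> is multiplicative from the loop to \<open>W\<close>, so its linear extension
  \<open>\<phi> : R \<rightarrow> W\<close> is a surjective algebra homomorphism, and it suffices to show that its kernel is
  \<open>I\<close>. Every generator of \<open>I\<close> is killed by \<open>\<phi>\<close>. Conversely, modulo \<open>I\<close> every element of \<open>R\<close> is
  congruent to a combination \<open>\<Sum> d\<^sub>g (1, g)\<close>, whose image is \<open>\<Sum> d\<^sub>g v\<^sub>g\<close>; if this vanishes, then all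
  \<open>d\<^sub>g\<close> are zero because the \<open>v\<^sub>g\<close> form a basis.
\<close>

section \<open>Quotients of nonassociative algebras\<close>

lemma nonassoc_algebraI:
  assumes "module K M"
    and "\<And>x y. \<lbrakk>x \<in> carrier M; y \<in> carrier M\<rbrakk> \<Longrightarrow> x \<otimes>\<^bsub>M\<^esub> y \<in> carrier M"
    and "\<And>x y z. \<lbrakk>x \<in> carrier M; y \<in> carrier M; z \<in> carrier M\<rbrakk> \<Longrightarrow>
      (x \<oplus>\<^bsub>M\<^esub> y) \<otimes>\<^bsub>M\<^esub> z = x \<otimes>\<^bsub>M\<^esub> z \<oplus>\<^bsub>M\<^esub> y \<otimes>\<^bsub>M\<^esub> z"
    and "\<And>x y z. \<lbrakk>x \<in> carrier M; y \<in> carrier M; z \<in> carrier M\<rbrakk> \<Longrightarrow>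
      z \<otimes>\<^bsub>M\<^esub> (x \<oplus>\<^bsub>M\<^esub> y) = z \<otimes>\<^bsub>M\<^esub> x \<oplus>\<^bsub>M\<^esub> z \<otimes>\<^bsub>M\<^esub> y"
    and "\<And>c x y. \<lbrakk>c \<in> carrier K; x \<in> carrier M; y \<in> carrier M\<rbrakk> \<Longrightarrow>
      (c \<odot>\<^bsub>M\<^esub> x) \<otimes>\<^bsub>M\<^esub> y = c \<odot>\<^bsub>M\<^esub> (x \<otimes>\<^bsub>M\<^esub> y)"
    and "\<And>c x y. \<lbrakk>c \<in> carrier K; x \<in> carrier M; y \<in> carrier M\<rbrakk> \<Longrightarrow>
      x \<otimes>\<^bsub>M\<^esub> (c \<odot>\<^bsub>M\<^esub> y) = c \<odot>\<^bsub>M\<^esub> (x \<otimes>\<^bsub>M\<^esub> y)"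
  shows "nonassoc_algebra K M"
  using assms by (intro nonassoc_algebra.intro nonassoc_algebra_axioms.intro)

text \<open>The zero vector is the scalar \<open>\<zero>\<close> times \<open>x\<close>; pulling
  that scalar out of the product leaves \<open>\<zero>\<close> times an element of the
  carrier.\<close>

lemma (in nonassoc_algebra) zero_mult: "x \<in> carrier M \<Longrightarrow> \<zero>\<^bsub>M\<^esub> \<otimes>\<^bsub>M\<^esub> x = \<zero>\<^bsub>M\<^esub>"
  using smult_mult_l[of \<zero> x x] mult_closed[of x x] by simp

lemma (in nonassoc_algebra) mult_zero: "x \<in> carrier M \<Longrightarrow> x \<otimes>\<^bsub>M\<^esub> \<zero>\<^bsub>M\<^esub> = \<zero>\<^bsub>M\<^esub>"
  using smult_mult_r[of \<zero> x x] mult_closed[of x x] by simp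

text \<open>Transport of structure: each element of \<open>Q\<close> has the form
  \<open>F w\<close>, so every axiom for \<open>Q\<close> is the image under \<open>F\<close> of the
  same axiom for \<open>M\<close>. It is applied with \<open>F\<close> the map sending a value to
  its coset.\<close>

lemma (in nonassoc_algebra) nonassoc_algebra_bij:
  fixes Q :: "('a, 'q) module" and F :: "'c \<Rightarrow> 'q"
  assumes bij: "bij_betw F (carrier M) (carrier Q)"
    and mult: "\<And>x y. \<lbrakk>x \<in> carrier M; y \<in> carrier M\<rbrakk> \<Longrightarrow> F x \<otimes>\<^bsub>Q\<^esub> F y = F (x \<otimes>\<^bsub>M\<^esub> y)"
    and add: "\<And>x y. \<lbrakk>x \<in> carrier M; y \<in> carrier M\<rbrakk> \<Longrightarrow> F x \<oplus>\<^bsub>Q\<^esub> F y = F (x \<oplus>\<^bsub>M\<^esub> y)"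
    and smult: "\<And>c x. \<lbrakk>c \<in> carrier R; x \<in> carrier M\<rbrakk> \<Longrightarrow> c \<odot>\<^bsub>Q\<^esub> F x = F (c \<odot>\<^bsub>M\<^esub> x)"
    and zero: "\<zero>\<^bsub>Q\<^esub> = F \<zero>\<^bsub>M\<^esub>"
  shows "nonassoc_algebra R Q"
proof -
  have car: "carrier Q = F ` carrier M"
    using bij by (simp add: bij_betw_def)
  note ops = car add mult smult zero mult_closed
  have "abelian_group Q"
  proof (rule abelian_groupI)
    fix x assume "x \<in> carrier Q"
    then obtain w where w: "w \<in> carrier M" "x = F w" by (auto simp: car)
    then have "F (\<ominus>\<^bsub>M\<^esub> w) \<oplus>\<^bsub>Q\<^esub> x = \<zero>\<^bsub>Q\<^esub>"
      by (simp add: ops M.l_neg)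
    with w show "\<exists>y\<in>carrier Q. y \<oplus>\<^bsub>Q\<^esub> x = \<zero>\<^bsub>Q\<^esub>"
      by (auto simp: car)
  qed (auto simp: ops M.add.m_ac)
  then have "module R Q"
    by (rule moduleI[OF R.is_cring])
      (auto simp: ops smult_l_distr smult_r_distr smult_assoc1)
  then show ?thesis
    by (rule nonassoc_algebraI)
      (auto simp: ops mult_l_distr mult_r_distr smult_mult_l smult_mult_r)
qed

text \<open>The coset map goes from the target algebra to the quotient, whereas the isomorphism
  wanted goes the other way; inverting the bijection turns each equation for \<open>F\<close>
  around.\<close>

lemma algebra_iso_inv_into:
  fixes F :: "'w \<Rightarrow> 'q"
  assumes N: "nonassoc_algebra K N"
    and bij: "bij_betw F (carrier N) (carrier Q)"
    and mult: "\<And>x y. \<lbrakk>x \<in> carrier N; y \<in> carrier N\<rbrakk> \<Longrightarrow> F x \<otimes>\<^bsub>Q\<^esub> F y = F (x \<otimes>\<^bsub>N\<^esub> y)"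
    and add: "\<And>x y. \<lbrakk>x \<in> carrier N; y \<in> carrier N\<rbrakk> \<Longrightarrow> F x \<oplus>\<^bsub>Q\<^esub> F y = F (x \<oplus>\<^bsub>N\<^esub> y)"
    and smult: "\<And>c x. \<lbrakk>c \<in> carrier K; x \<in> carrier N\<rbrakk> \<Longrightarrow> c \<odot>\<^bsub>Q\<^esub> F x = F (c \<odot>\<^bsub>N\<^esub> x)"
    and one: "\<one>\<^bsub>N\<^esub> \<in> carrier N" "\<one>\<^bsub>Q\<^esub> = F \<one>\<^bsub>N\<^esub>"
  shows "inv_into (carrier N) F \<in> algebra_iso K Q N"
proof -
  interpret N: nonassoc_algebra K N by fact
  have car: "carrier Q = F ` carrier N" and inj: "inj_on F (carrier N)"
    using bij by (auto simp: bij_betw_def)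
  have inv: "inv_into (carrier N) F (F w) = w" if "w \<in> carrier N" for w
    using inj that by simp
  show ?thesis
    unfolding algebra_iso_def ring_iso_def ring_hom_def
    using bij_betw_inv_into[OF bij] one
    by (auto simp: car mult add smult inv N.mult_closed)
qed

text \<open>Preservation of the unit is left out, in keeping with \<open>nonassoc_algebra\<close>,
  which does not constrain \<open>one\<close>; it is asked for only where a \<open>ring_iso\<close>
  is produced.\<close>

locale algebra_epi = M: nonassoc_algebra K M + N: nonassoc_algebra K N
  for K (structure) and M and N +
  fixes \<phi>
  assumes hom_mult: "\<lbrakk>x \<in> carrier M; y \<in> carrier M\<rbrakk> \<Longrightarrow> \<phi> (x \<otimes>\<^bsub>M\<^esub> y) = \<phi> x \<otimes>\<^bsub>N\<^esub> \<phi> y"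
    and hom_add: "\<lbrakk>x \<in> carrier M; y \<in> carrier M\<rbrakk> \<Longrightarrow> \<phi> (x \<oplus>\<^bsub>M\<^esub> y) = \<phi> x \<oplus>\<^bsub>N\<^esub> \<phi> y"
    and hom_smult: "\<lbrakk>c \<in> carrier K; x \<in> carrier M\<rbrakk> \<Longrightarrow> \<phi> (c \<odot>\<^bsub>M\<^esub> x) = c \<odot>\<^bsub>N\<^esub> \<phi> x"
    and surj: "\<phi> ` carrier M = carrier N"
begin

lemma hom_closed: "x \<in> carrier M \<Longrightarrow> \<phi> x \<in> carrier N"
  using surj by blast

lemma hom_zero: "\<phi> \<zero>\<^bsub>M\<^esub> = \<zero>\<^bsub>N\<^esub>"
  using hom_smult[of \<zero> "\<zero>\<^bsub>M\<^esub>"] hom_closed[of "\<zero>\<^bsub>M\<^esub>"] by simp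

lemma hom_uminus:
  assumes x: "x \<in> carrier M"
  shows "\<phi> (\<ominus>\<^bsub>M\<^esub> x) = \<ominus>\<^bsub>N\<^esub> \<phi> x"
proof -
  have "\<phi> (\<ominus>\<^bsub>M\<^esub> x) \<oplus>\<^bsub>N\<^esub> \<phi> x = \<zero>\<^bsub>N\<^esub>"
    using x hom_add[of "\<ominus>\<^bsub>M\<^esub> x" x] by (simp add: M.M.l_neg hom_zero)
  then show ?thesis
    using x by (simp add: N.M.minus_equality hom_closed)
qed

abbreviation ker where "ker \<equiv> {x \<in> carrier M. \<phi> x = \<zero>\<^bsub>N\<^esub>}"

lemma submodule_ker: "submodule ker K M"
  by (rule M.submoduleI) (auto simp: hom_zero hom_uminus hom_add hom_smult)

lemma algebra_ideal_ker: "algebra_ideal K M ker"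
proof -
  show ?thesis
    by (intro algebra_ideal.intro algebra_ideal_axioms.intro submodule_ker M.nonassoc_algebra_axioms)
      (auto simp: hom_mult hom_closed M.mult_closed N.zero_mult N.mult_zero)
qed

text \<open>
  The cosets of the kernel are the fibers of \<open>\<phi>\<close>, so the isomorphism theorem is obtained by
  transporting the structure of \<open>N\<close> along \<open>fiber\<close>, without representatives.
\<close>

definition fiber where "fiber w = {x \<in> carrier M. \<phi> x = w}"

text \<open>Elements with the same image differ by an element of the kernel: writing
  \<open>y\<close> as \<open>(y - x) + x\<close> puts the whole fiber into the coset.\<close>

lemma r_coset_ker:
  assumes x: "x \<in> carrier M"
  shows "ker +>\<^bsub>M\<^esub> x = fiber (\<phi> x)"
proof
  show "ker +>\<^bsub>M\<^esub> x \<subseteq> fiber (\<phi> x)"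
    using x by (auto simp: a_r_coset_def r_coset_def fiber_def hom_add hom_closed)
  show "fiber (\<phi> x) \<subseteq> ker +>\<^bsub>M\<^esub> x"
  proof
    fix y assume "y \<in> fiber (\<phi> x)"
    then have y: "y \<in> carrier M" "\<phi> y = \<phi> x" by (auto simp: fiber_def)
    with x have "y \<ominus>\<^bsub>M\<^esub> x \<in> ker" "y = (y \<ominus>\<^bsub>M\<^esub> x) \<oplus>\<^bsub>M\<^esub> x"
      by (auto simp: hom_add hom_uminus hom_closed a_minus_def N.M.r_neg M.M.a_assoc M.M.l_neg)
    then show "y \<in> ker +>\<^bsub>M\<^esub> x"
      unfolding a_r_coset_def r_coset_def by auto
  qed
qed

text \<open>This is how surjectivity is used: nonempty fibers over different points are different,
  and a union of equal sets indexed by a nonempty fiber is that set.\<close>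

lemma fiber_nonempty:
  assumes "w \<in> carrier N"
  shows "\<exists>x. x \<in> fiber w"
proof -
  have "w \<in> \<phi> ` carrier M" using assms by (simp add: surj)
  then show ?thesis by (auto simp: fiber_def)
qed

lemma carrier_quotient: "carrier (quotient_algebra M ker) = fiber ` carrier N"
proof -
  have "carrier (quotient_algebra M ker) = (\<lambda>x. ker +>\<^bsub>M\<^esub> x) ` carrier M"
    by (auto simp: quotient_algebra_def A_RCOSETS_def RCOSETS_def a_r_coset_def)
  also have "\<dots> = fiber ` \<phi> ` carrier M"
    unfolding image_image by (intro image_cong) (auto simp: r_coset_ker)
  finally show ?thesis by (simp add: surj)
qed

lemma bij_fiber: "bij_betw fiber (carrier N) (carrier (quotient_algebra M ker))"
proof -
  have "u = w" if "u \<in> carrier N" "fiber u = fiber w" for u w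
    using fiber_nonempty[OF that(1)] that(2) by (auto simp: fiber_def)
  then show ?thesis
    unfolding bij_betw_def carrier_quotient inj_on_def by blast
qed

lemma fiber_mult:
  assumes "u \<in> carrier N" "w \<in> carrier N"
  shows "fiber u \<otimes>\<^bsub>quotient_algebra M ker\<^esub> fiber w = fiber (u \<otimes>\<^bsub>N\<^esub> w)"
proof -
  \<comment> \<open>\<open>rcoset_mult\<close> is a union over all pairs of representatives; every
    member of it is the same fiber.\<close>
  have "ker +>\<^bsub>M\<^esub> (a \<otimes>\<^bsub>M\<^esub> b) = fiber (u \<otimes>\<^bsub>N\<^esub> w)" if "a \<in> fiber u" "b \<in> fiber w" for a b
    using that by (subst r_coset_ker) (auto simp: fiber_def hom_mult M.mult_closed)
  then show ?thesis
    using assms[THEN fiber_nonempty] by (auto simp: quotient_algebra_def rcoset_mult_def)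
qed

lemma fiber_smult:
  assumes "c \<in> carrier K" "w \<in> carrier N"
  shows "c \<odot>\<^bsub>quotient_algebra M ker\<^esub> fiber w = fiber (c \<odot>\<^bsub>N\<^esub> w)"
proof -
  have "ker +>\<^bsub>M\<^esub> (c \<odot>\<^bsub>M\<^esub> x) = fiber (c \<odot>\<^bsub>N\<^esub> w)" if "x \<in> fiber w" for x
    using that assms by (subst r_coset_ker) (auto simp: fiber_def hom_smult)
  then show ?thesis
    using assms(2)[THEN fiber_nonempty] by (auto simp: quotient_algebra_def)
qed

lemma fiber_add:
  assumes "u \<in> carrier N" "w \<in> carrier N"
  shows "fiber u \<oplus>\<^bsub>quotient_algebra M ker\<^esub> fiber w = fiber (u \<oplus>\<^bsub>N\<^esub> w)"
proof -
  have "fiber u <+>\<^bsub>M\<^esub> fiber w = fiber (u \<oplus>\<^bsub>N\<^esub> w)"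
  proof
    show "fiber u <+>\<^bsub>M\<^esub> fiber w \<subseteq> fiber (u \<oplus>\<^bsub>N\<^esub> w)"
      by (auto simp: set_add_def set_mult_def fiber_def hom_add)
    show "fiber (u \<oplus>\<^bsub>N\<^esub> w) \<subseteq> fiber u <+>\<^bsub>M\<^esub> fiber w"
    proof
      fix y assume y: "y \<in> fiber (u \<oplus>\<^bsub>N\<^esub> w)"
      \<comment> \<open>Any element of \<open>fiber w\<close> will do, since the difference of
        \<open>y\<close> and \<open>b\<close> then maps to \<open>u\<close>.\<close>
      obtain b where b: "b \<in> fiber w" using assms fiber_nonempty by blast
      have "y \<ominus>\<^bsub>M\<^esub> b \<in> fiber u" "y = (y \<ominus>\<^bsub>M\<^esub> b) \<oplus>\<^bsub>M\<^esub> b"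
        using y b assms
        by (auto simp: fiber_def hom_add hom_uminus a_minus_def N.M.r_neg N.M.a_assoc M.M.a_assoc M.M.l_neg)
      with b show "y \<in> fiber u <+>\<^bsub>M\<^esub> fiber w"
        unfolding set_add_def set_mult_def by auto
    qed
  qed
  then show ?thesis by (simp add: quotient_algebra_def)
qed

text \<open>Once the structure is transported along \<open>fiber\<close>, it remains to see that the
  zero of the quotient, which is \<open>ker\<close> itself, is the fiber over zero.\<close>

lemma nonassoc_algebra_quotient: "nonassoc_algebra K (quotient_algebra M ker)"
  by (rule N.nonassoc_algebra_bij[OF bij_fiber fiber_mult fiber_add fiber_smult])
    (auto simp: quotient_algebra_def fiber_def)

lemma algebra_iso_quotient:
  assumes "\<one>\<^bsub>M\<^esub> \<in> carrier M" "\<phi> \<one>\<^bsub>M\<^esub> = \<one>\<^bsub>N\<^esub>"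
  shows "inv_into (carrier N) fiber \<in> algebra_iso K (quotient_algebra M ker) N"
  using assms hom_closed[OF assms(1)]
  by (intro algebra_iso_inv_into N.nonassoc_algebra_axioms bij_fiber fiber_mult fiber_add fiber_smult)
    (auto simp: quotient_algebra_def r_coset_ker)

end

section \<open>Loop rings\<close>

lemma loop_ring_simps:
  "f \<oplus>\<^bsub>loop_ring K L\<^esub> h = (\<lambda>z. f z \<oplus>\<^bsub>K\<^esub> h z)"
  "\<zero>\<^bsub>loop_ring K L\<^esub> = (\<lambda>_. \<zero>\<^bsub>K\<^esub>)"
  "c \<odot>\<^bsub>loop_ring K L\<^esub> f = (\<lambda>z. c \<otimes>\<^bsub>K\<^esub> f z)"
  "\<one>\<^bsub>loop_ring K L\<^esub> = loop_basis K \<one>\<^bsub>L\<^esub>"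
  by (simp_all add: loop_ring_def)

locale loop_algebra = K?: cring K
  for K (structure) and L :: "('l, 'n) monoid_scheme" +
  assumes loop_closed: "\<lbrakk>x \<in> carrier L; y \<in> carrier L\<rbrakk> \<Longrightarrow> x \<otimes>\<^bsub>L\<^esub> y \<in> carrier L"
begin

abbreviation supp where "supp f \<equiv> {x. f x \<noteq> \<zero>}"

abbreviation KL where "KL \<equiv> loop_ring K L"

lemma carrier_KL:
  "f \<in> carrier KL \<longleftrightarrow> (\<forall>x. f x \<in> carrier K) \<and> finite (supp f) \<and> supp f \<subseteq> carrier L"
  by (auto simp: loop_ring_def)

lemma coeff_closed: "f \<in> carrier KL \<Longrightarrow> f x \<in> carrier K"
  by (simp add: carrier_KL)

text \<open>Cancellation can shrink supports, so a finite bound \<open>S\<close> is used instead of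
  the exact support.\<close>

lemma carrier_KLI:
  assumes "\<And>x. f x \<in> carrier K" "finite S" "S \<subseteq> carrier L" "supp f \<subseteq> S"
  shows "f \<in> carrier KL"
  using assms by (auto simp: carrier_KL intro: finite_subset)

lemma supp_loop_basis: "supp (loop_basis K x) \<subseteq> {x}"
  by (auto simp: loop_basis_def)

lemma loop_basis_closed: "x \<in> carrier L \<Longrightarrow> loop_basis K x \<in> carrier KL"
  using supp_loop_basis by (rule carrier_KLI[rotated -1]) (auto simp: loop_basis_def)

lemma add_closed_KL:
  assumes "f \<in> carrier KL" "h \<in> carrier KL"
  shows "f \<oplus>\<^bsub>KL\<^esub> h \<in> carrier KL"
  using assms
  by (intro carrier_KLI[where S = "supp f \<union> supp h"]) (auto simp: carrier_KL loop_ring_simps)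

lemma smult_closed_KL:
  assumes "c \<in> carrier K" "f \<in> carrier KL"
  shows "c \<odot>\<^bsub>KL\<^esub> f \<in> carrier KL"
  using assms by (intro carrier_KLI[where S = "supp f"]) (auto simp: carrier_KL loop_ring_simps)

lemma zero_closed_KL: "\<zero>\<^bsub>KL\<^esub> \<in> carrier KL"
  by (rule carrier_KLI[where S = "{}"]) (auto simp: loop_ring_simps)

lemma abelian_group_KL: "abelian_group KL"
proof (rule abelian_groupI)
  fix f assume f: "f \<in> carrier KL"
  \<comment> \<open>The additive inverse is taken as a scalar multiple, so its membership follows
    from \<open>smult_closed_KL\<close>.\<close>
  have "(\<ominus> \<one>) \<odot>\<^bsub>KL\<^esub> f \<oplus>\<^bsub>KL\<^esub> f = \<zero>\<^bsub>KL\<^esub>"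
    using f by (auto simp: loop_ring_simps K.l_minus K.l_neg coeff_closed)
  with f show "\<exists>h\<in>carrier KL. h \<oplus>\<^bsub>KL\<^esub> f = \<zero>\<^bsub>KL\<^esub>"
    by (metis smult_closed_KL K.one_closed K.a_inv_closed)
qed (auto simp: loop_ring_simps(1,2) coeff_closed K.add.m_ac
      add_closed_KL[unfolded loop_ring_simps] zero_closed_KL[unfolded loop_ring_simps])

lemma module_KL: "module K KL"
  by (rule moduleI[OF K.is_cring abelian_group_KL])
    (auto simp: smult_closed_KL, auto simp: loop_ring_simps coeff_closed K.l_distr K.r_distr K.m_assoc)

sublocale KL: module K KL
  by (rule module_KL)

text \<open>Enlarging the index set from the exact supports to \<open>S\<close> and \<open>T\<close>
  adds only zero terms. This allows several products to be written as sums over one common index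
  set.\<close>

lemma mult_eq:
  assumes f: "f \<in> carrier KL" "finite S" "supp f \<subseteq> S"
    and h: "h \<in> carrier KL" "finite T" "supp h \<subseteq> T"
  shows "(f \<otimes>\<^bsub>KL\<^esub> h) z = (\<Oplus>p\<in>{p \<in> S \<times> T. fst p \<otimes>\<^bsub>L\<^esub> snd p = z}. f (fst p) \<otimes> h (snd p))"
proof -
  have "(f \<otimes>\<^bsub>KL\<^esub> h) z =
      (\<Oplus>p\<in>{(x, y). f x \<noteq> \<zero> \<and> h y \<noteq> \<zero> \<and> x \<otimes>\<^bsub>L\<^esub> y = z}. f (fst p) \<otimes> h (snd p))"
    by (simp add: loop_ring_def)
  also have "\<dots> = (\<Oplus>p\<in>{p \<in> S \<times> T. fst p \<otimes>\<^bsub>L\<^esub> snd p = z}. f (fst p) \<otimes> h (snd p))"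
    using assms by (intro K.add.finprod_mono_neutral_cong_left) (auto simp: coeff_closed)
  finally show ?thesis .
qed

lemma mult_closed_KL:
  assumes f: "f \<in> carrier KL" and h: "h \<in> carrier KL"
  shows "f \<otimes>\<^bsub>KL\<^esub> h \<in> carrier KL"
proof (rule carrier_KLI)
  \<comment> \<open>All products of support elements: a finite bound for the support of the
    convolution.\<close>
  let ?S = "(\<lambda>(x, y). x \<otimes>\<^bsub>L\<^esub> y) ` (supp f \<times> supp h)"
  have eq: "(f \<otimes>\<^bsub>KL\<^esub> h) z =
      (\<Oplus>p\<in>{p \<in> supp f \<times> supp h. fst p \<otimes>\<^bsub>L\<^esub> snd p = z}. f (fst p) \<otimes> h (snd p))" for z
    using f h by (intro mult_eq) (auto simp: carrier_KL)
  show "(f \<otimes>\<^bsub>KL\<^esub> h) z \<in> carrier K" for z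
    unfolding eq using f h by (intro K.finsum_closed) (auto simp: coeff_closed)
  show "finite ?S" "?S \<subseteq> carrier L"
    using f h by (auto simp: carrier_KL subset_iff intro!: loop_closed)
  show "supp (f \<otimes>\<^bsub>KL\<^esub> h) \<subseteq> ?S"
  proof
    fix z assume "z \<in> supp (f \<otimes>\<^bsub>KL\<^esub> h)"
    \<comment> \<open>An empty index set would make the coefficient at \<open>z\<close>
      zero.\<close>
    then have "{p \<in> supp f \<times> supp h. fst p \<otimes>\<^bsub>L\<^esub> snd p = z} \<noteq> {}"
      unfolding mem_Collect_eq eq by (metis K.finsum_empty)
    then show "z \<in> ?S" by force
  qed
qed

lemma nonassoc_algebra_KL: "nonassoc_algebra K KL"
proof (rule nonassoc_algebraI[OF module_KL mult_closed_KL])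
  fix f g h assume fgh: "f \<in> carrier KL" "g \<in> carrier KL" "h \<in> carrier KL"
  \<comment> \<open>One index set serving \<open>f\<close>, \<open>g\<close> and their sum, so that
    the distributive laws hold term by term.\<close>
  let ?S = "supp f \<union> supp g" and ?T = "supp h"
  have sub: "supp (f \<oplus>\<^bsub>KL\<^esub> g) \<subseteq> ?S"
    by (auto simp: loop_ring_simps)
  have fin: "finite ?S" "finite ?T"
    using fgh by (auto simp: carrier_KL)
  show "(f \<oplus>\<^bsub>KL\<^esub> g) \<otimes>\<^bsub>KL\<^esub> h = f \<otimes>\<^bsub>KL\<^esub> h \<oplus>\<^bsub>KL\<^esub> g \<otimes>\<^bsub>KL\<^esub> h"
  proof
    fix z
    let ?P = "{p \<in> ?S \<times> ?T. fst p \<otimes>\<^bsub>L\<^esub> snd p = z}"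
    have "((f \<oplus>\<^bsub>KL\<^esub> g) \<otimes>\<^bsub>KL\<^esub> h) z =
        (\<Oplus>p\<in>?P. f (fst p) \<otimes> h (snd p) \<oplus> g (fst p) \<otimes> h (snd p))"
      using fgh
      by (subst mult_eq[OF add_closed_KL fin(1) sub _ fin(2) order_refl])
        (auto simp: loop_ring_simps coeff_closed K.l_distr intro!: K.finsum_cong')
    also have "\<dots> = (f \<otimes>\<^bsub>KL\<^esub> h) z \<oplus> (g \<otimes>\<^bsub>KL\<^esub> h) z"
      using fgh fin
      by (subst (1 2) mult_eq[where S = ?S and T = ?T])
        (auto simp: coeff_closed intro!: K.finsum_addf)
    finally show "((f \<oplus>\<^bsub>KL\<^esub> g) \<otimes>\<^bsub>KL\<^esub> h) z = (f \<otimes>\<^bsub>KL\<^esub> h \<oplus>\<^bsub>KL\<^esub> g \<otimes>\<^bsub>KL\<^esub> h) z"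
      by (simp add: loop_ring_simps)
  qed
  show "h \<otimes>\<^bsub>KL\<^esub> (f \<oplus>\<^bsub>KL\<^esub> g) = h \<otimes>\<^bsub>KL\<^esub> f \<oplus>\<^bsub>KL\<^esub> h \<otimes>\<^bsub>KL\<^esub> g"
  proof
    fix z
    let ?P = "{p \<in> ?T \<times> ?S. fst p \<otimes>\<^bsub>L\<^esub> snd p = z}"
    have "(h \<otimes>\<^bsub>KL\<^esub> (f \<oplus>\<^bsub>KL\<^esub> g)) z =
        (\<Oplus>p\<in>?P. h (fst p) \<otimes> f (snd p) \<oplus> h (fst p) \<otimes> g (snd p))"
      using fgh
      by (subst mult_eq[OF _ fin(2) order_refl add_closed_KL fin(1) sub])
        (auto simp: loop_ring_simps coeff_closed K.r_distr intro!: K.finsum_cong')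
    also have "\<dots> = (h \<otimes>\<^bsub>KL\<^esub> f) z \<oplus> (h \<otimes>\<^bsub>KL\<^esub> g) z"
      using fgh fin
      by (subst (1 2) mult_eq[where S = ?T and T = ?S])
        (auto simp: coeff_closed intro!: K.finsum_addf)
    finally show "(h \<otimes>\<^bsub>KL\<^esub> (f \<oplus>\<^bsub>KL\<^esub> g)) z = (h \<otimes>\<^bsub>KL\<^esub> f \<oplus>\<^bsub>KL\<^esub> h \<otimes>\<^bsub>KL\<^esub> g) z"
      by (simp add: loop_ring_simps)
  qed
next
  fix c f h assume c: "c \<in> carrier K" and fh: "f \<in> carrier KL" "h \<in> carrier KL"
  have sub: "supp (c \<odot>\<^bsub>KL\<^esub> f) \<subseteq> supp f" "supp (c \<odot>\<^bsub>KL\<^esub> h) \<subseteq> supp h"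
    using c by (auto simp: loop_ring_simps)
  have fin: "finite (supp f)" "finite (supp h)"
    using fh by (auto simp: carrier_KL)
  \<comment> \<open>Both scalar laws reduce to this sum. Scaling by \<open>c\<close> may shrink a
    support, which \<open>mult_eq\<close> permits; commutativity of \<open>K\<close> moves
    \<open>c\<close> past the coefficients of \<open>f\<close> in the right-hand law.\<close>
  have main: "(\<Oplus>p\<in>{p \<in> supp f \<times> supp h. fst p \<otimes>\<^bsub>L\<^esub> snd p = z}. c \<otimes> (f (fst p) \<otimes> h (snd p)))
      = (c \<odot>\<^bsub>KL\<^esub> (f \<otimes>\<^bsub>KL\<^esub> h)) z" for z
    unfolding loop_ring_simps using fh fin c
    by (subst mult_eq[where S = "supp f" and T = "supp h"])
      (auto simp: coeff_closed intro!: K.finsum_rdistr[symmetric])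
  show "(c \<odot>\<^bsub>KL\<^esub> f) \<otimes>\<^bsub>KL\<^esub> h = c \<odot>\<^bsub>KL\<^esub> (f \<otimes>\<^bsub>KL\<^esub> h)"
    unfolding fun_eq_iff main[symmetric] using fh c
    by (subst mult_eq[OF smult_closed_KL fin(1) sub(1) _ fin(2) order_refl])
      (auto simp: loop_ring_simps coeff_closed K.m_assoc intro!: K.finsum_cong')
  show "f \<otimes>\<^bsub>KL\<^esub> (c \<odot>\<^bsub>KL\<^esub> h) = c \<odot>\<^bsub>KL\<^esub> (f \<otimes>\<^bsub>KL\<^esub> h)"
    unfolding fun_eq_iff main[symmetric] using fh c
    by (subst mult_eq[OF _ fin(1) order_refl smult_closed_KL fin(2) sub(2)])
      (auto simp: loop_ring_simps coeff_closed K.m_lcomm intro!: K.finsum_cong')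
qed

sublocale KL: nonassoc_algebra K KL
  by (rule nonassoc_algebra_KL)

lemma loop_basis_mult:
  assumes x: "x \<in> carrier L" and y: "y \<in> carrier L"
  shows "loop_basis K x \<otimes>\<^bsub>KL\<^esub> loop_basis K y = loop_basis K (x \<otimes>\<^bsub>L\<^esub> y)"
proof
  fix z
  have "(loop_basis K x \<otimes>\<^bsub>KL\<^esub> loop_basis K y) z =
      (\<Oplus>p\<in>{p \<in> {x} \<times> {y}. fst p \<otimes>\<^bsub>L\<^esub> snd p = z}. loop_basis K x (fst p) \<otimes> loop_basis K y (snd p))"
    using x y by (intro mult_eq loop_basis_closed supp_loop_basis) auto
  \<comment> \<open>Only the pair \<open>(x, y)\<close> can contribute, and it does so only at its
    own product.\<close>
  also have "{p \<in> {x} \<times> {y}. fst p \<otimes>\<^bsub>L\<^esub> snd p = z} = (if z = x \<otimes>\<^bsub>L\<^esub> y then {(x, y)} else {})"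
    by auto
  also have "(\<Oplus>p\<in>\<dots>. loop_basis K x (fst p) \<otimes> loop_basis K y (snd p)) = loop_basis K (x \<otimes>\<^bsub>L\<^esub> y) z"
    by (simp add: loop_basis_def)
  finally show "(loop_basis K x \<otimes>\<^bsub>KL\<^esub> loop_basis K y) z = loop_basis K (x \<otimes>\<^bsub>L\<^esub> y) z" .
qed

text \<open>Finite support makes every element a linear combination of basis elements, so a property
  stable under linear operations need only be checked on \<open>loop_basis\<close>.\<close>

lemma KL_induct [consumes 1, case_names zero add smult basis]:
  assumes f: "f \<in> carrier KL"
    and zero: "P \<zero>\<^bsub>KL\<^esub>"
    and add: "\<And>f h. \<lbrakk>f \<in> carrier KL; h \<in> carrier KL; P f; P h\<rbrakk> \<Longrightarrow> P (f \<oplus>\<^bsub>KL\<^esub> h)"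
    and smult: "\<And>c f. \<lbrakk>c \<in> carrier K; f \<in> carrier KL; P f\<rbrakk> \<Longrightarrow> P (c \<odot>\<^bsub>KL\<^esub> f)"
    and basis: "\<And>x. x \<in> carrier L \<Longrightarrow> P (loop_basis K x)"
  shows "P f"
proof -
  \<comment> \<open>Induction on a bound \<open>S\<close> for the support: erasing the coefficient
    at \<open>x\<close> leaves an element bounded by the smaller set, and \<open>f x\<close> times
    the basis element at \<open>x\<close> restores it.\<close>
  have "P f" if "finite S" "S \<subseteq> carrier L" "f \<in> carrier KL" "supp f \<subseteq> S" for S f
    using that
  proof (induction S arbitrary: f rule: finite_induct)
    case empty
    then have "f = \<zero>\<^bsub>KL\<^esub>" by (auto simp: loop_ring_simps)
    then show ?case using zero by simp
  next
    case (insert x S)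
    let ?f = "f(x := \<zero>)"
    have f': "?f \<in> carrier KL"
      using insert.prems by (intro carrier_KLI[where S = "supp f"]) (auto simp: carrier_KL)
    have S: "S \<subseteq> carrier L" "supp ?f \<subseteq> S" and x: "x \<in> carrier L"
      using insert.prems by auto
    have "P ?f"
      by (rule insert.IH[OF S(1) f' S(2)])
    then have "P (?f \<oplus>\<^bsub>KL\<^esub> f x \<odot>\<^bsub>KL\<^esub> loop_basis K x)"
      using insert.prems x f'
      by (intro add smult basis smult_closed_KL loop_basis_closed coeff_closed)
    moreover have "?f \<oplus>\<^bsub>KL\<^esub> f x \<odot>\<^bsub>KL\<^esub> loop_basis K x = f"
      using insert.prems(2) by (auto simp: loop_ring_simps loop_basis_def coeff_closed)
    ultimately show ?case by (simp only:)
  qed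
  then show ?thesis using f by (auto simp: carrier_KL)
qed

end

section \<open>Linear extension of multiplicative maps\<close>

text \<open>A multiplicative map from the loop into the algebra \<open>W\<close>, the analogue of a
  representation; its linear extension will be an algebra homomorphism.\<close>

locale loop_representation = loop_algebra K L + W: nonassoc_algebra K W
  for K (structure) and L :: "('l, 'n) monoid_scheme" and W +
  fixes u
  assumes u_closed: "x \<in> carrier L \<Longrightarrow> u x \<in> carrier W"
    and u_mult: "\<lbrakk>x \<in> carrier L; y \<in> carrier L\<rbrakk> \<Longrightarrow> u (x \<otimes>\<^bsub>L\<^esub> y) = u x \<otimes>\<^bsub>W\<^esub> u y"
begin

definition linext where "linext f = (\<Oplus>\<^bsub>W\<^esub>x\<in>supp f. f x \<odot>\<^bsub>W\<^esub> u x)"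

text \<open>The counterpart of \<open>mult_eq\<close>: outside the support the terms are zero, so
  elements with different supports can be summed over a common set.\<close>

lemma linext_eq:
  assumes "f \<in> carrier KL" "finite S" "supp f \<subseteq> S" "S \<subseteq> carrier L"
  shows "linext f = (\<Oplus>\<^bsub>W\<^esub>x\<in>S. f x \<odot>\<^bsub>W\<^esub> u x)"
  unfolding linext_def using assms
  by (intro W.M.add.finprod_mono_neutral_cong_left) (auto simp: coeff_closed u_closed subset_iff)

lemma linext_closed: "f \<in> carrier KL \<Longrightarrow> linext f \<in> carrier W"
  unfolding linext_def by (intro W.M.finsum_closed) (auto simp: carrier_KL u_closed)

lemma linext_zero: "linext \<zero>\<^bsub>KL\<^esub> = \<zero>\<^bsub>W\<^esub>"
  by (simp add: linext_def loop_ring_simps)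

lemma linext_add:
  assumes fh: "f \<in> carrier KL" "h \<in> carrier KL"
  shows "linext (f \<oplus>\<^bsub>KL\<^esub> h) = linext f \<oplus>\<^bsub>W\<^esub> linext h"
proof -
  let ?S = "supp f \<union> supp h"
  have S: "finite ?S" "?S \<subseteq> carrier L" using fh by (auto simp: carrier_KL)
  have "linext (f \<oplus>\<^bsub>KL\<^esub> h) = (\<Oplus>\<^bsub>W\<^esub>x\<in>?S. (f \<oplus>\<^bsub>KL\<^esub> h) x \<odot>\<^bsub>W\<^esub> u x)"
    using fh S by (intro linext_eq add_closed_KL) (auto simp: loop_ring_simps)
  also have "\<dots> = (\<Oplus>\<^bsub>W\<^esub>x\<in>?S. f x \<odot>\<^bsub>W\<^esub> u x \<oplus>\<^bsub>W\<^esub> h x \<odot>\<^bsub>W\<^esub> u x)"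
    using fh S
    by (intro W.M.finsum_cong' refl)
      (auto simp: loop_ring_simps W.smult_l_distr coeff_closed u_closed subset_iff)
  also have "\<dots> = linext f \<oplus>\<^bsub>W\<^esub> linext h"
    using fh S
    by (subst (1 2) linext_eq[where S = ?S])
      (auto simp: coeff_closed u_closed subset_iff intro!: W.M.finsum_addf)
  finally show ?thesis .
qed

lemma linext_smult:
  assumes c: "c \<in> carrier K" and f: "f \<in> carrier KL"
  shows "linext (c \<odot>\<^bsub>KL\<^esub> f) = c \<odot>\<^bsub>W\<^esub> linext f"
proof -
  have S: "finite (supp f)" "supp f \<subseteq> carrier L" using f by (auto simp: carrier_KL)
  have "linext (c \<odot>\<^bsub>KL\<^esub> f) = (\<Oplus>\<^bsub>W\<^esub>x\<in>supp f. c \<odot>\<^bsub>W\<^esub> (f x \<odot>\<^bsub>W\<^esub> u x))"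
    using c f S
    by (subst linext_eq[OF smult_closed_KL S(1) _ S(2)])
      (auto simp: loop_ring_simps W.smult_assoc1 coeff_closed u_closed subset_iff
        intro!: W.M.finsum_cong')
  also have "\<dots> = c \<odot>\<^bsub>W\<^esub> linext f"
    unfolding linext_def using c f S
    by (intro W.finsum_smult_ldistr[symmetric]) (auto simp: coeff_closed u_closed subset_iff)
  finally show ?thesis .
qed

lemma linext_basis:
  assumes "x \<in> carrier L"
  shows "linext (loop_basis K x) = u x"
proof -
  have "linext (loop_basis K x) = (\<Oplus>\<^bsub>W\<^esub>y\<in>{x}. loop_basis K x y \<odot>\<^bsub>W\<^esub> u y)"
    using assms by (intro linext_eq loop_basis_closed supp_loop_basis) auto
  also have "\<dots> = u x"
    using assms by (simp add: loop_basis_def u_closed)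
  finally show ?thesis .
qed

text \<open>Both sides are bilinear, so induction on \<open>f\<close> and then on \<open>h\<close>
  reduces the claim to two basis elements, where it is the multiplicativity of
  \<open>u\<close>.\<close>

lemma linext_mult:
  assumes f: "f \<in> carrier KL" and h: "h \<in> carrier KL"
  shows "linext (f \<otimes>\<^bsub>KL\<^esub> h) = linext f \<otimes>\<^bsub>W\<^esub> linext h"
  using f
proof (induction f rule: KL_induct)
  case zero
  then show ?case
    using h by (simp add: KL.zero_mult linext_zero W.zero_mult linext_closed)
next
  case (add f g)
  then show ?case
    using h by (simp add: KL.mult_l_distr linext_add W.mult_l_distr linext_closed KL.mult_closed)
next
  case (smult c f)
  then show ?case
    using h by (simp add: KL.smult_mult_l linext_smult W.smult_mult_l linext_closed KL.mult_closed)
next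
  case (basis x)
  note x = loop_basis_closed[OF basis]
  show ?case
    using h
  proof (induction h rule: KL_induct)
    case zero
    then show ?case
      using x by (simp add: KL.mult_zero linext_zero W.mult_zero linext_closed)
  next
    case (add f g)
    then show ?case
      using x by (simp add: KL.mult_r_distr linext_add W.mult_r_distr linext_closed KL.mult_closed)
  next
    case (smult c f)
    then show ?case
      using x by (simp add: KL.smult_mult_r linext_smult W.smult_mult_r linext_closed KL.mult_closed)
  next
    case (basis y)
    then show ?case
      using \<open>x \<in> carrier L\<close> by (simp add: loop_basis_mult linext_basis loop_closed u_mult)
  qed
qed

end

section \<open>Twisted algebras as quotients of loop rings\<close>

theorem theorem1:
  fixes K :: "('k, 'r) ring_scheme"
    and G :: "('g, 'h) monoid_scheme"
    and W :: "('k, 'w, 'm) module_scheme"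
    and V :: "'g \<Rightarrow> 'w set"
    and v :: "'g \<Rightarrow> 'w"
    and C :: "'g \<Rightarrow> 'g \<Rightarrow> 'k"
    and A :: "'k set"
    and R :: "('k, 'k \<times> 'g \<Rightarrow> 'k) module"
    and I :: "('k \<times> 'g \<Rightarrow> 'k) set"
  assumes "field K"
    and "group G" and "finite (carrier G)"
    and "graded_twisted_algebra K G W V"
    and "is_basis K W (carrier G) v"
    and "\<And>g. g \<in> carrier G \<Longrightarrow> v g \<in> V g"
    and "v \<one>\<^bsub>G\<^esub> = \<one>\<^bsub>W\<^esub>"
    and "structure_constant K G W v C"
    and "subgroup A (mult_of K)"
    and "\<And>a b. \<lbrakk>a \<in> carrier G; b \<in> carrier G\<rbrakk> \<Longrightarrow> C a b \<in> A"
    and "R = loop_ring K (twisted_loop K A C G)"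
    and "I = lin_span K R
           {loop_basis K (\<alpha>, g) \<ominus>\<^bsub>R\<^esub> \<alpha> \<odot>\<^bsub>R\<^esub> loop_basis K (\<one>\<^bsub>K\<^esub>, g) | \<alpha> g.
              \<alpha> \<in> A \<and> g \<in> carrier G}"
  shows "algebra_ideal K R I
    \<and> nonassoc_algebra K (quotient_algebra R I)
    \<and> algebra_iso K (quotient_algebra R I) W \<noteq> {}"
proof -
  let ?L = "twisted_loop K A C G"

  \<comment> \<open>The scalars, the basis and the loop\<close>
  define u where "u = (\<lambda>(\<alpha>, g). \<alpha> \<odot>\<^bsub>W\<^esub> v g)"
  interpret K: field K by fact
  interpret G: group G by fact
  interpret W: nonassoc_algebra K W
    using assms(4) by (rule graded_twisted_algebra.axioms(1))
  have A: "\<alpha> \<in> carrier K" if "\<alpha> \<in> A" for \<alpha>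
    using subgroup.subset[OF assms(9)] that by auto
  have A_mult: "\<alpha> \<otimes>\<^bsub>K\<^esub> \<beta> \<in> A" if "\<alpha> \<in> A" "\<beta> \<in> A" for \<alpha> \<beta>
    using subgroup.m_closed[OF assms(9) that] by simp
  have A_one: "\<one>\<^bsub>K\<^esub> \<in> A"
    using subgroup.one_closed[OF assms(9)] by simp
  have v: "v g \<in> carrier W" if "g \<in> carrier G" for g
    using assms(5) that by (auto simp: is_basis_def)
  have coords: "\<exists>!c. c \<in> carrier G \<rightarrow>\<^sub>E carrier K \<and> finite {g \<in> carrier G. c g \<noteq> \<zero>\<^bsub>K\<^esub>} \<and>
      w = (\<Oplus>\<^bsub>W\<^esub>g\<in>{g \<in> carrier G. c g \<noteq> \<zero>\<^bsub>K\<^esub>}. c g \<odot>\<^bsub>W\<^esub> v g)" if "w \<in> carrier W" for w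
    using assms(5) that unfolding is_basis_def by blast
  \<comment> \<open>Linear independence of \<open>v\<close>, read off from uniqueness of coordinates
    at the zero vector.\<close>
  have coords_zero: "c = c'"
    if "finite {g \<in> carrier G. c g \<noteq> \<zero>\<^bsub>K\<^esub>}"
      "\<zero>\<^bsub>W\<^esub> = (\<Oplus>\<^bsub>W\<^esub>g\<in>{g \<in> carrier G. c g \<noteq> \<zero>\<^bsub>K\<^esub>}. c g \<odot>\<^bsub>W\<^esub> v g)"
      "finite {g \<in> carrier G. c' g \<noteq> \<zero>\<^bsub>K\<^esub>}"
      "\<zero>\<^bsub>W\<^esub> = (\<Oplus>\<^bsub>W\<^esub>g\<in>{g \<in> carrier G. c' g \<noteq> \<zero>\<^bsub>K\<^esub>}. c' g \<odot>\<^bsub>W\<^esub> v g)"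
      "c \<in> carrier G \<rightarrow>\<^sub>E carrier K" "c' \<in> carrier G \<rightarrow>\<^sub>E carrier K" for c c'
    using coords[OF W.M.zero_closed] that by blast
  have v_mult: "v a \<otimes>\<^bsub>W\<^esub> v b = C a b \<odot>\<^bsub>W\<^esub> v (a \<otimes>\<^bsub>G\<^esub> b)" if "a \<in> carrier G" "b \<in> carrier G" for a b
    using assms(8) that by (simp add: structure_constant_def)
  have L_carrier: "carrier ?L = A \<times> carrier G"
    and L_mult: "(\<alpha>, a) \<otimes>\<^bsub>?L\<^esub> (\<beta>, b) = (\<alpha> \<otimes>\<^bsub>K\<^esub> \<beta> \<otimes>\<^bsub>K\<^esub> C a b, a \<otimes>\<^bsub>G\<^esub> b)"
    and L_one: "\<one>\<^bsub>?L\<^esub> = (\<one>\<^bsub>K\<^esub>, \<one>\<^bsub>G\<^esub>)" for \<alpha> \<beta> a b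
    by (simp_all add: twisted_loop_def)

  \<comment> \<open>The representation of the loop on the twisted algebra\<close>
  interpret rep: loop_representation K ?L W u
  proof unfold_locales
    fix x y assume "x \<in> carrier ?L" "y \<in> carrier ?L"
    then obtain \<alpha> a \<beta> b where xy: "x = (\<alpha>, a)" "y = (\<beta>, b)"
      and in_A: "\<alpha> \<in> A" "\<beta> \<in> A" and in_G: "a \<in> carrier G" "b \<in> carrier G"
      by (auto simp: L_carrier)
    note C = assms(10)[OF in_G]
    show "x \<otimes>\<^bsub>?L\<^esub> y \<in> carrier ?L"
      using in_A in_G C by (simp add: xy L_carrier L_mult A_mult)
    \<comment> \<open>The twist in the loop operation is made for this: both sides are
      \<open>\<alpha> \<beta> C(a, b)\<close> times the basis vector at \<open>ab\<close>.\<close>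
    show "u (x \<otimes>\<^bsub>?L\<^esub> y) = u x \<otimes>\<^bsub>W\<^esub> u y"
      using in_A in_G C
      by (simp add: xy u_def A v L_mult v_mult W.smult_mult_l W.smult_mult_r W.mult_closed
          W.smult_assoc1[symmetric] K.m_ac)
  next
    show "u x \<in> carrier W" if "x \<in> carrier ?L" for x
      using that by (auto simp: L_carrier u_def A v)
  qed
  \<comment> \<open>On elements supported on the pairs \<open>(1, g)\<close> the linear extension is
    a coordinate expansion in the basis \<open>v\<close>. Existence of coordinates will give
    surjectivity, their uniqueness the kernel.\<close>
  have linext_normal:
    "rep.linext d = (\<Oplus>\<^bsub>W\<^esub>g\<in>{g \<in> carrier G. d (\<one>\<^bsub>K\<^esub>, g) \<noteq> \<zero>\<^bsub>K\<^esub>}. d (\<one>\<^bsub>K\<^esub>, g) \<odot>\<^bsub>W\<^esub> v g)"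
    if d: "d \<in> carrier R" "rep.supp d \<subseteq> {\<one>\<^bsub>K\<^esub>} \<times> carrier G" for d
  proof -
    have supp: "rep.supp d = Pair \<one>\<^bsub>K\<^esub> ` {g \<in> carrier G. d (\<one>\<^bsub>K\<^esub>, g) \<noteq> \<zero>\<^bsub>K\<^esub>}"
      using d(2) by auto
    show ?thesis
      unfolding rep.linext_def supp using d(1)
      by (subst W.M.finsum_reindex)
        (auto simp: assms(11) u_def v rep.coeff_closed inj_on_def intro!: W.M.finsum_cong')
  qed

  \<comment> \<open>Surjectivity of the linear extension\<close>
  have "rep.linext ` carrier R = carrier W"
  proof
    show "rep.linext ` carrier R \<subseteq> carrier W"
      by (auto simp: assms(11) rep.linext_closed)
    show "carrier W \<subseteq> rep.linext ` carrier R"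
    proof
      fix w assume "w \<in> carrier W"
      then obtain c where c: "c \<in> carrier G \<rightarrow>\<^sub>E carrier K"
          "finite {g \<in> carrier G. c g \<noteq> \<zero>\<^bsub>K\<^esub>}"
          "w = (\<Oplus>\<^bsub>W\<^esub>g\<in>{g \<in> carrier G. c g \<noteq> \<zero>\<^bsub>K\<^esub>}. c g \<odot>\<^bsub>W\<^esub> v g)"
        using coords by blast
      \<comment> \<open>The preimage carries the coordinates of \<open>w\<close> on the pairs
        \<open>(1, g)\<close>, which belong to the loop because \<open>A\<close> contains 1.\<close>
      define d where "d = (\<lambda>(\<alpha>, g). if \<alpha> = \<one>\<^bsub>K\<^esub> \<and> g \<in> carrier G then c g else \<zero>\<^bsub>K\<^esub>)"
      have supp: "rep.supp d \<subseteq> {\<one>\<^bsub>K\<^esub>} \<times> {g \<in> carrier G. c g \<noteq> \<zero>\<^bsub>K\<^esub>}"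
        by (auto simp: d_def split: if_splits)
      have d: "d \<in> carrier R"
        unfolding assms(11) using c(1,2) A_one supp
        by (intro rep.carrier_KLI[where S = "{\<one>\<^bsub>K\<^esub>} \<times> {g \<in> carrier G. c g \<noteq> \<zero>\<^bsub>K\<^esub>}"])
          (auto simp: d_def L_carrier)
      have "rep.linext d = w"
        unfolding c(3) using supp d c(1)
        by (subst linext_normal) (auto simp: d_def v intro!: W.M.finsum_cong')
      with d show "w \<in> rep.linext ` carrier R" by blast
    qed
  qed
  then interpret epi: algebra_epi K R W rep.linext
    unfolding assms(11)
    by unfold_locales (simp_all add: rep.linext_mult rep.linext_add rep.linext_smult)

  \<comment> \<open>The kernel is the span of the generators\<close>
  let ?S = "{loop_basis K (\<alpha>, g) \<ominus>\<^bsub>R\<^esub> \<alpha> \<odot>\<^bsub>R\<^esub> loop_basis K (\<one>\<^bsub>K\<^esub>, g) | \<alpha> g.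
              \<alpha> \<in> A \<and> g \<in> carrier G}"
  have basis_closed: "loop_basis K (\<alpha>, g) \<in> carrier R"
    and linext_basis: "rep.linext (loop_basis K (\<alpha>, g)) = \<alpha> \<odot>\<^bsub>W\<^esub> v g"
    if "\<alpha> \<in> A" "g \<in> carrier G" for \<alpha> g
    using that rep.loop_basis_closed[of "(\<alpha>, g)"] rep.linext_basis[of "(\<alpha>, g)"]
    by (simp_all add: assms(11) L_carrier u_def)
  have "?S \<subseteq> epi.ker"
  proof
    fix x assume "x \<in> ?S"
    then obtain \<alpha> g where "\<alpha> \<in> A" "g \<in> carrier G"
      and "x = loop_basis K (\<alpha>, g) \<ominus>\<^bsub>R\<^esub> \<alpha> \<odot>\<^bsub>R\<^esub> loop_basis K (\<one>\<^bsub>K\<^esub>, g)"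
      by blast
    \<comment> \<open>Both terms of the difference map to \<open>\<alpha>\<close> times
      \<open>v g\<close>.\<close>
    then show "x \<in> epi.ker"
      by (simp add: a_minus_def epi.hom_add epi.hom_uminus epi.hom_smult basis_closed linext_basis A A_one v W.M.r_neg)
  qed
  \<comment> \<open>Since \<open>I\<close> is a hull, it equals the kernel once the kernel is shown
    to be the least submodule containing \<open>?S\<close>.\<close>
  moreover have "epi.ker \<subseteq> T" if T: "submodule T K R" and S: "?S \<subseteq> T" for T
  proof
    note T_closed = epi.M.submoduleE[OF T]
    have zero_T: "\<zero>\<^bsub>R\<^esub> \<in> T"
      using subgroup.one_closed[OF submodule.axioms(1)[OF T]] by simp
    have T_carrier: "t \<in> carrier R" if "t \<in> T" for t
      using T_closed(1) that by blast
    \<comment> \<open>\<open>T\<close> is an arbitrary submodule containing the generators and may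
      reach outside the kernel, so the equality of images of \<open>d\<close> and \<open>f\<close>
      cannot be deduced from \<open>t \<in> T\<close> and is carried through the induction.\<close>
    have normal_form: "\<exists>t\<in>T. \<exists>d\<in>carrier R. f = t \<oplus>\<^bsub>R\<^esub> d \<and> rep.linext d = rep.linext f \<and>
        rep.supp d \<subseteq> {\<one>\<^bsub>K\<^esub>} \<times> carrier G" if "f \<in> carrier R" for f
      using that
    proof (induction f rule: rep.KL_induct[folded assms(11), consumes 1, case_names zero add smult basis])
      case zero
      have "rep.supp \<zero>\<^bsub>R\<^esub> \<subseteq> {\<one>\<^bsub>K\<^esub>} \<times> carrier G"
        by (simp add: assms(11) loop_ring_simps)
      then show ?case
        using zero_T by (intro bexI[of _ "\<zero>\<^bsub>R\<^esub>"]) simp_all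
    next
      case (add f h)
      then obtain t d t' d' where T': "t \<in> T" "t' \<in> T" and d: "d \<in> carrier R" "d' \<in> carrier R"
        and eq: "f = t \<oplus>\<^bsub>R\<^esub> d" "h = t' \<oplus>\<^bsub>R\<^esub> d'"
        and hom: "rep.linext d = rep.linext f" "rep.linext d' = rep.linext h"
        and supp: "rep.supp d \<subseteq> {\<one>\<^bsub>K\<^esub>} \<times> carrier G" "rep.supp d' \<subseteq> {\<one>\<^bsub>K\<^esub>} \<times> carrier G"
        by meson
      have "f \<oplus>\<^bsub>R\<^esub> h = (t \<oplus>\<^bsub>R\<^esub> t') \<oplus>\<^bsub>R\<^esub> (d \<oplus>\<^bsub>R\<^esub> d')"
        using T' d by (simp add: eq T_carrier epi.M.M.add.m_ac)
      moreover have "rep.linext (d \<oplus>\<^bsub>R\<^esub> d') = rep.linext (f \<oplus>\<^bsub>R\<^esub> h)"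
        using add.hyps d by (simp add: epi.hom_add hom)
      moreover have "rep.supp (d \<oplus>\<^bsub>R\<^esub> d') \<subseteq> rep.supp d \<union> rep.supp d'"
        by (auto simp: assms(11) loop_ring_simps)
      then have "rep.supp (d \<oplus>\<^bsub>R\<^esub> d') \<subseteq> {\<one>\<^bsub>K\<^esub>} \<times> carrier G"
        using supp by blast
      ultimately show ?case
        using T_closed(5)[OF T'] d by blast
    next
      case (smult c f)
      then obtain t d where T': "t \<in> T" and d: "d \<in> carrier R" and eq: "f = t \<oplus>\<^bsub>R\<^esub> d"
        and hom: "rep.linext d = rep.linext f" and supp: "rep.supp d \<subseteq> {\<one>\<^bsub>K\<^esub>} \<times> carrier G"
        by meson
      have "c \<odot>\<^bsub>R\<^esub> f = (c \<odot>\<^bsub>R\<^esub> t) \<oplus>\<^bsub>R\<^esub> (c \<odot>\<^bsub>R\<^esub> d)"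
        using T' d smult.hyps by (simp add: eq T_carrier epi.M.smult_r_distr)
      moreover have "rep.linext (c \<odot>\<^bsub>R\<^esub> d) = rep.linext (c \<odot>\<^bsub>R\<^esub> f)"
        using smult.hyps d by (simp add: epi.hom_smult hom)
      moreover have "rep.supp (c \<odot>\<^bsub>R\<^esub> d) \<subseteq> rep.supp d"
        using smult.hyps by (auto simp: assms(11) loop_ring_simps)
      then have "rep.supp (c \<odot>\<^bsub>R\<^esub> d) \<subseteq> {\<one>\<^bsub>K\<^esub>} \<times> carrier G"
        using supp by blast
      ultimately show ?case
        using T_closed(4)[OF smult.hyps(1) T'] d smult.hyps(1) by blast
    next
      case (basis x)
      then obtain \<alpha> g where x: "x = (\<alpha>, g)" and in_AG: "\<alpha> \<in> A" "g \<in> carrier G"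
        by (auto simp: L_carrier)
      \<comment> \<open>Chosen so that subtracting it from the basis element at \<open>x\<close>
        gives exactly one of the generators.\<close>
      let ?d = "\<alpha> \<odot>\<^bsub>R\<^esub> loop_basis K (\<one>\<^bsub>K\<^esub>, g)"
      note e = basis_closed[OF in_AG] basis_closed[OF A_one in_AG(2)]
      have d: "?d \<in> carrier R"
        using in_AG e by (simp add: A)
      have "loop_basis K x \<ominus>\<^bsub>R\<^esub> ?d \<in> T"
        using S in_AG unfolding x by blast
      moreover have "loop_basis K x = (loop_basis K x \<ominus>\<^bsub>R\<^esub> ?d) \<oplus>\<^bsub>R\<^esub> ?d"
        using d e by (simp add: x a_minus_def epi.M.M.a_assoc epi.M.M.l_neg)
      moreover have "rep.linext ?d = rep.linext (loop_basis K x)"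
        using in_AG e by (simp add: x epi.hom_smult linext_basis A A_one v)
      moreover have "rep.supp ?d \<subseteq> {\<one>\<^bsub>K\<^esub>} \<times> carrier G"
        using in_AG by (auto simp: assms(11) loop_ring_simps loop_basis_def A split: if_splits)
      ultimately show ?case
        using d by blast
    qed
    fix f assume f: "f \<in> epi.ker"
    then obtain t d where t: "t \<in> T" "f = t \<oplus>\<^bsub>R\<^esub> d" and d: "d \<in> carrier R"
      and hom: "rep.linext d = rep.linext f" and supp: "rep.supp d \<subseteq> {\<one>\<^bsub>K\<^esub>} \<times> carrier G"
      using normal_form by blast
    \<comment> \<open>Both functions are restricted to \<open>carrier G\<close> because
      \<open>is_basis\<close> asserts uniqueness among extensional functions. They are two
      coordinate functions of the zero vector.\<close>
    let ?c = "\<lambda>g\<in>carrier G. d (\<one>\<^bsub>K\<^esub>, g)" and ?z = "\<lambda>g\<in>carrier G. \<zero>\<^bsub>K\<^esub>"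
    have coeff: "d x \<in> carrier K" for x
      using d by (simp add: assms(11) rep.coeff_closed)
    have eq: "{g \<in> carrier G. ?c g \<noteq> \<zero>\<^bsub>K\<^esub>} = {g \<in> carrier G. d (\<one>\<^bsub>K\<^esub>, g) \<noteq> \<zero>\<^bsub>K\<^esub>}"
      by auto
    have "{g \<in> carrier G. ?c g \<noteq> \<zero>\<^bsub>K\<^esub>} \<subseteq> snd ` rep.supp d"
      by force
    moreover have "finite (rep.supp d)"
      using d by (simp add: assms(11) rep.carrier_KL)
    ultimately have "finite {g \<in> carrier G. ?c g \<noteq> \<zero>\<^bsub>K\<^esub>}"
      by (meson finite_imageI finite_subset)
    moreover have "\<zero>\<^bsub>W\<^esub> = (\<Oplus>\<^bsub>W\<^esub>g\<in>{g \<in> carrier G. ?c g \<noteq> \<zero>\<^bsub>K\<^esub>}. ?c g \<odot>\<^bsub>W\<^esub> v g)"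
    proof -
      have "\<zero>\<^bsub>W\<^esub> = rep.linext d"
        using f hom by simp
      also have "\<dots> = (\<Oplus>\<^bsub>W\<^esub>g\<in>{g \<in> carrier G. ?c g \<noteq> \<zero>\<^bsub>K\<^esub>}. ?c g \<odot>\<^bsub>W\<^esub> v g)"
        unfolding linext_normal[OF d supp] eq
        by (intro W.M.finsum_cong') (auto simp: coeff v)
      finally show ?thesis .
    qed
    ultimately have "?c = ?z"
      by (rule coords_zero) (auto simp: coeff cong: conj_cong)
    then have "d (\<one>\<^bsub>K\<^esub>, g) = \<zero>\<^bsub>K\<^esub>" if "g \<in> carrier G" for g
      using that by (metis restrict_apply')
    \<comment> \<open>Off the pairs \<open>(1, g)\<close> the coefficients vanish by
      \<open>supp\<close>; hence \<open>f\<close> is just \<open>t\<close>.\<close>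
    then have "d = \<zero>\<^bsub>R\<^esub>"
      using supp by (auto simp: assms(11) loop_ring_simps)
    then show "f \<in> T"
      using t by (simp add: T_carrier)
  qed
  ultimately have I: "I = epi.ker"
    unfolding assms(12) lin_span_def by (intro hull_unique epi.submodule_ker)
  \<comment> \<open>The unit of \<open>R\<close> is the basis element at \<open>(1, e)\<close>,
    which maps to \<open>v\<close> at the identity; the normalization of the basis makes this the
    unit of \<open>W\<close>.\<close>
  have "\<one>\<^bsub>R\<^esub> = loop_basis K (\<one>\<^bsub>K\<^esub>, \<one>\<^bsub>G\<^esub>)"
    by (simp add: assms(11) loop_ring_simps L_one)
  then have "\<one>\<^bsub>R\<^esub> \<in> carrier R" "rep.linext \<one>\<^bsub>R\<^esub> = \<one>\<^bsub>W\<^esub>"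
    using v[of "\<one>\<^bsub>G\<^esub>"] by (simp_all add: basis_closed linext_basis A_one assms(7))
  then show ?thesis
    unfolding I
    using epi.algebra_ideal_ker epi.nonassoc_algebra_quotient epi.algebra_iso_quotient by blast
qed

end
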